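(* Let $\mathbb{F}$ be a field, $E=\mathbb{F}^n$, and let $\mathcal{S}$ be the set of spanning spaces of a $q$-matroid with ground space $E$. Then $(E,\mathcal{S})$ is a $q$-$\Delta$-matroid.
   Context: $E=\mathbb{F}^n$ is a finite-dimensional vector space over a field $\mathbb{F}$. A $q$-matroid on $E$ is a pair $M=(E,r)$ with $r$ an integer-valued function on the subspaces of $E$ such that (R1) $0\le r(A)\le\dim A$ for every subspace $A$; (R2) $r(A)\le r(B)$ whenever $A\subseteq B$; (R3) $r(A+B)+r(A\cap B)\le r(A)+r(B)$ for all subspaces $A,B$. A subspace $S$ is spanning if $r(S)=r(E)$. A $q$-$\Delta$-matroid is a pair $(E,\mathcal{F})$ with $\mathcal{F}$ a non-empty family of subspaces of $E$ satisfying: (F1) For all $X,Y\in\mathcal{F}$ and each subspace $A$ of codimension $1$ in $X$, either (i) there is a codimension-$1$ subspace $Z\subseteq E$ with $A\subseteq Z$, $Y\not\subseteq Z$, such that $A+z\in\mathcal{F}$ for all $1$-dimensional $z\subseteq E$ with $z\not\subseteq Z$; or (ii) there is a codimension-$1$ subspace $Z\subseteq E$ such that $Z\cap A\in\mathcal{F}$. (F2) For all $X,Y\in\mathcal{F}$ and each subspace $A\subseteq E$ in which $X$ has codimension $1$, either (iii) there is a $1$-dimensional $z\subseteq A$, $z\not\subseteq Y$, such that $A\cap Z\in\mathcal{F}$ for every codimension-$1$ subspace $Z\subseteq E$ with $z\not\subseteq Z$; or (iv) there is a $1$-dimensional $z\subseteq E$ such that $A+z\in\mathcal{F}$. *)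

theory Defs
  imports Complex_Main "HOL-Library.Set_Algebras"
begin

(* The ground space E is the whole type 'b, with scalar multiplication scale over a field 'a.
   E = F^n is rendered as "finite_dimensional_vector_space scale Basis", where n = card Basis;
   Basis = {} (that is, n = 0) is allowed. For n >= 1 the concrete space 'a ^ 'n of HOL-Analysis, with
   vector_scalar_mult and cart_basis, is an instance.
   For sets of vectors, A + B is the elementwise sum from HOL-Library.Set_Algebras. *)

context finite_dimensional_vector_space
begin

definition codim1_in :: "'b set \<Rightarrow> 'b set \<Rightarrow> bool" where
  "codim1_in A X \<longleftrightarrow> subspace A \<and> subspace X \<and> A \<subseteq> X \<and> dim X = dim A + 1"

definition one_dim :: "'b set \<Rightarrow> bool" where
  "one_dim z \<longleftrightarrow> subspace z \<and> dim z = 1"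

(* A rank function is only meaningful on subspaces; its values on other sets are irrelevant. *)
definition q_matroid :: "('b set \<Rightarrow> int) \<Rightarrow> bool" where
  "q_matroid r \<longleftrightarrow>
     (\<forall>A. subspace A \<longrightarrow> 0 \<le> r A \<and> r A \<le> int (dim A)) \<and>
     (\<forall>A B. subspace A \<and> subspace B \<and> A \<subseteq> B \<longrightarrow> r A \<le> r B) \<and>
     (\<forall>A B. subspace A \<and> subspace B \<longrightarrow> r (A + B) + r (A \<inter> B) \<le> r A + r B)"

definition spanning_spaces :: "('b set \<Rightarrow> int) \<Rightarrow> 'b set set" where
  "spanning_spaces r = {S. subspace S \<and> r S = r UNIV}"

definition q_delta_F1 :: "'b set set \<Rightarrow> bool" where
  "q_delta_F1 \<F> \<longleftrightarrow>
     (\<forall>X\<in>\<F>. \<forall>Y\<in>\<F>. \<forall>A. codim1_in A X \<longrightarrow>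
        (\<exists>Z. codim1_in Z UNIV \<and> A \<subseteq> Z \<and> \<not> Y \<subseteq> Z \<and>
             (\<forall>z. one_dim z \<and> \<not> z \<subseteq> Z \<longrightarrow> A + z \<in> \<F>)) \<or>
        (\<exists>Z. codim1_in Z UNIV \<and> Z \<inter> A \<in> \<F>))"

definition q_delta_F2 :: "'b set set \<Rightarrow> bool" where
  "q_delta_F2 \<F> \<longleftrightarrow>
     (\<forall>X\<in>\<F>. \<forall>Y\<in>\<F>. \<forall>A. codim1_in X A \<longrightarrow>
        (\<exists>z. one_dim z \<and> z \<subseteq> A \<and> \<not> z \<subseteq> Y \<and>
             (\<forall>Z. codim1_in Z UNIV \<and> \<not> z \<subseteq> Z \<longrightarrow> A \<inter> Z \<in> \<F>)) \<or>
        (\<exists>z. one_dim z \<and> A + z \<in> \<F>))"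

definition q_delta_matroid :: "'b set set \<Rightarrow> bool" where
  "q_delta_matroid \<F> \<longleftrightarrow>
     \<F> \<noteq> {} \<and> (\<forall>X\<in>\<F>. subspace X) \<and> q_delta_F1 \<F> \<and> q_delta_F2 \<F>"

end

end

(* Every superspace of a spanning space is spanning, so (F2) always holds through (iv) with z inside A,
   and (F1) holds through (ii) with Z containing A whenever A is spanning. Otherwise r(A) = r(E) - 1;
   take Z to be a hyperplane that contains a flat of rank r(A) above A but omits some vector of Y. *)

theory Submission imports Defs begin

context finite_dimensional_vector_space
begin

lemma subspace_set_plus: "subspace A \<Longrightarrow> subspace B \<Longrightarrow> subspace (A + B)"
  using subspace_sums[of A B] by (simp add: set_plus_def Bex_def) (smt (verit) Collect_cong)

lemma subset_set_plus_left: "subspace B \<Longrightarrow> A \<subseteq> A + B"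
  by (force simp: set_plus_def dest: subspace_0)

lemma subset_set_plus_right: "subspace A \<Longrightarrow> B \<subseteq> A + B"
  by (force simp: set_plus_def dest: subspace_0)

lemma set_plus_subset_subspace: "subspace C \<Longrightarrow> A \<subseteq> C \<Longrightarrow> B \<subseteq> C \<Longrightarrow> A + B \<subseteq> C"
  by (auto simp: set_plus_def subspace_add subset_iff)

lemma one_dim_span_singleton: "x \<noteq> 0 \<Longrightarrow> one_dim (span {x})"
  by (auto simp: one_dim_def dim_insert)

text \<open>A basis of \<open>C\<close> stays independent when \<open>y\<close> is added, since
  \<open>y\<close> lies outside its span. Extend it to a basis \<open>D\<close> of the whole space
  and delete \<open>y\<close>: the remaining vectors span the required hyperplane.\<close>

lemma hyperplane_avoiding_vector:
  assumes C: "subspace C" and y: "y \<notin> C"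
  obtains Z where "codim1_in Z UNIV" "C \<subseteq> Z" "y \<notin> Z"
proof -
  obtain B where B: "B \<subseteq> C" "independent B" "C \<subseteq> span B"
    by (meson basis_exists)
  have "span B = C"
    using B C by (simp add: span_minimal subset_antisym)
  then have ind: "independent (insert y B)"
    using B(2) y by (simp add: independent_insertI)
  have "y \<notin> B"
    using B(1) y by blast
  define D where "D = extend_basis (insert y B)"
  have D: "independent D" "span D = UNIV" "insert y B \<subseteq> D"
    unfolding D_def
    by (fact independent_extend_basis[OF ind] span_extend_basis[OF ind] extend_basis_superset[OF ind])+
  have "dim (UNIV :: 'b set) = card D"
    using D by (metis dim_eq_card_independent dim_span)
  moreover have "dim (span (D - {y})) = card (D - {y})"
    using D(1) by (metis Diff_subset dim_eq_card_independent dim_span independent_mono)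
  moreover have "finite D" and "y \<in> D"
    using D by (auto simp: finiteI_independent)
  then have "card D = card (D - {y}) + 1"
    by (metis Suc_eq_plus1 card_Suc_Diff1)
  ultimately have "codim1_in (span (D - {y})) UNIV"
    unfolding codim1_in_def by (simp only: subspace_UNIV subspace_span subset_UNIV)
  moreover have "C \<subseteq> span (D - {y})"
    using span_mono[of B "D - {y}"] \<open>span B = C\<close> \<open>y \<notin> B\<close> D(3) by blast
  moreover have "y \<notin> span (D - {y})"
    using D(1) \<open>y \<in> D\<close> by (auto simp: dependent_def)
  ultimately show thesis
    using that by blast
qed

context
  fixes r :: "'b set \<Rightarrow> int"
  assumes q_matroid: "q_matroid r"
begin

lemma rank_nonneg: "subspace A \<Longrightarrow> 0 \<le> r A"
  and rank_le_dim: "subspace A \<Longrightarrow> r A \<le> int (dim A)"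
  and rank_mono: "subspace A \<Longrightarrow> subspace B \<Longrightarrow> A \<subseteq> B \<Longrightarrow> r A \<le> r B"
  and rank_submodular: "subspace A \<Longrightarrow> subspace B \<Longrightarrow> r (A + B) + r (A \<inter> B) \<le> r A + r B"
  using q_matroid by (auto simp: q_matroid_def)

text \<open>Submodularity for \<open>A\<close> and \<open>z\<close>, with \<open>r z \<le> 1\<close>
  and \<open>r (A \<inter> z) \<ge> 0\<close>.\<close>

lemma rank_set_plus_one_dim_le:
  assumes "subspace A" "one_dim z"
  shows "r (A + z) \<le> r A + 1"
  using rank_submodular[of A z] rank_nonneg[of "A \<inter> z"] rank_le_dim[of z] assms
  by (auto simp: one_dim_def subspace_inter)

text \<open>For any \<open>x\<close> in \<open>X\<close> outside \<open>A\<close>, \<open>X\<close>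
  is \<open>A + span {x}\<close>, so the bound for adding a one-dimensional space applies.\<close>

lemma rank_le_codim1:
  assumes "codim1_in A X"
  shows "r X \<le> r A + 1"
proof -
  have A: "subspace A" and X: "subspace X" and "A \<subseteq> X" and dim: "dim X = dim A + 1"
    using assms by (auto simp: codim1_in_def)
  then obtain x where x: "x \<in> X" "x \<notin> A"
    by (metis add_cancel_right_right subsetI subset_antisym zero_neq_one)
  then have z: "one_dim (span {x})"
    using A subspace_0 one_dim_span_singleton by metis
  have sub: "subspace (A + span {x})"
    using A by (simp add: subspace_set_plus)
  \<comment> \<open>Dimension count: \<open>insert x A\<close> already has dimension
    \<open>dim A + 1 = dim X\<close>, so \<open>A + span {x}\<close>, a subspace of
    \<open>X\<close>, must be all of \<open>X\<close>.\<close>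
  have "insert x A \<subseteq> A + span {x}"
    using subset_set_plus_left[of "span {x}" A] subset_set_plus_right[of A "span {x}"] A
    by (auto simp: span_base)
  then have "dim (insert x A) \<le> dim (A + span {x})"
    by (rule dim_subset)
  moreover have "dim (insert x A) = dim X"
    using x A dim by (simp add: dim_insert span_eq_iff[THEN iffD2])
  moreover have "A + span {x} \<subseteq> X"
    using X x \<open>A \<subseteq> X\<close> by (simp add: set_plus_subset_subspace span_minimal)
  ultimately have "A + span {x} = X"
    using X sub by (metis subspace_dim_equal)
  then show ?thesis
    using rank_set_plus_one_dim_le[OF A z] by simp
qed

text \<open>Monotonicity squeezes \<open>r B\<close> between \<open>r A = r UNIV\<close> and
  \<open>r UNIV\<close>.\<close>

lemma spanning_superset:
  assumes "A \<in> spanning_spaces r" "subspace B" "A \<subseteq> B"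
  shows "B \<in> spanning_spaces r"
  using assms rank_mono[of A B] rank_mono[of B UNIV] by (auto simp: spanning_spaces_def)

text \<open>\<open>C\<close> has maximal dimension among the subspaces above \<open>A\<close> of
  rank \<open>r A\<close>. The strict increase is stated for \<open>A + z\<close> rather than
  \<open>C + z\<close>, because (F1) adds \<open>z\<close> to \<open>A\<close>; submodularity
  carries it from \<open>C\<close> down to \<open>A\<close>.\<close>

lemma exists_flat:
  assumes A: "subspace A"
  obtains C where "subspace C" "A \<subseteq> C" "r C = r A"
    "\<And>z. subspace z \<Longrightarrow> \<not> z \<subseteq> C \<Longrightarrow> r A < r (A + z)"
proof -
  define P where "P C \<longleftrightarrow> subspace C \<and> A \<subseteq> C \<and> r C = r A" for C
  have "P A"
    using A by (simp add: P_def)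
  then obtain C where "P C" and max: "\<And>C'. P C' \<Longrightarrow> dim C' \<le> dim C"
    using ex_has_greatest_nat[of P A dim "Suc dimension"] dim_subset_UNIV less_Suc_eq_le by metis
  then have C: "subspace C" "A \<subseteq> C" "r C = r A"
    by (auto simp: P_def)
  have "r A < r (A + z)" if z: "subspace z" "\<not> z \<subseteq> C" for z
  proof (rule ccontr)
    assume "\<not> r A < r (A + z)"
    \<comment> \<open>The intersection contains \<open>A\<close> and so has rank at least
      \<open>r A\<close>, while both terms on the right are at most \<open>r A\<close>. Hence
      \<open>C + (A + z)\<close> still has rank \<open>r A\<close>, and maximality of
      \<open>C\<close> forces \<open>z\<close> into \<open>C\<close>.\<close>
    moreover have "r (C + (A + z)) + r (C \<inter> (A + z)) \<le> r C + r (A + z)"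
      using A C z by (intro rank_submodular subspace_set_plus)
    moreover have "r A \<le> r (C \<inter> (A + z))"
      using A C z by (intro rank_mono subspace_inter subspace_set_plus) (auto dest: subset_set_plus_left)
    moreover have sub: "subspace (C + (A + z))"
      using A C z by (intro subspace_set_plus)
    moreover have le: "C \<subseteq> C + (A + z)"
      using A z by (intro subset_set_plus_left subspace_set_plus)
    moreover have "r C \<le> r (C + (A + z))"
      using C sub le by (intro rank_mono)
    ultimately have "P (C + (A + z))"
      using C by (auto simp: P_def)
    then have "C = C + (A + z)"
      using max C(1) sub le by (metis subspace_dim_equal)
    moreover have "z \<subseteq> C + (A + z)"
      using A C z by (meson subset_set_plus_right subset_trans subspace_set_plus)
    ultimately show False
      using z(2) by simp
  qed
  with C that show thesis
    by blast
qed

lemma spanning_spaces_F1: "q_delta_F1 (spanning_spaces r)"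
  unfolding q_delta_F1_def
proof (intro ballI allI impI)
  fix X Y A
  assume X: "X \<in> spanning_spaces r" and Y: "Y \<in> spanning_spaces r" and AX: "codim1_in A X"
  have A: "subspace A"
    using AX by (simp add: codim1_in_def)
  show "(\<exists>Z. codim1_in Z UNIV \<and> A \<subseteq> Z \<and> \<not> Y \<subseteq> Z \<and>
             (\<forall>z. one_dim z \<and> \<not> z \<subseteq> Z \<longrightarrow> A + z \<in> spanning_spaces r)) \<or>
        (\<exists>Z. codim1_in Z UNIV \<and> Z \<inter> A \<in> spanning_spaces r)"
  proof (cases "A \<in> spanning_spaces r")
    case True
    \<comment> \<open>\<open>A\<close> is proper in \<open>X\<close>, so some hyperplane
      \<open>Z\<close> contains \<open>A\<close>, and then \<open>Z \<inter> A = A\<close> is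
      spanning.\<close>
    obtain x where "x \<notin> A"
      using AX by (metis UNIV_I add_cancel_right_right codim1_in_def subsetI subset_antisym zero_neq_one)
    then obtain Z where "codim1_in Z UNIV" "A \<subseteq> Z"
      using A hyperplane_avoiding_vector by metis
    then show ?thesis
      using True by (metis inf.absorb2)
  next
    case False
    then have "r A < r UNIV"
      using A rank_mono[of A UNIV] by (auto simp: spanning_spaces_def)
    obtain C where C: "subspace C" "A \<subseteq> C" "r C = r A"
      and flat: "\<And>z. subspace z \<Longrightarrow> \<not> z \<subseteq> C \<Longrightarrow> r A < r (A + z)"
      using exists_flat[OF A] by metis
    \<comment> \<open>\<open>Y\<close> has full rank while \<open>r C = r A < r UNIV\<close>, so
      monotonicity excludes the inclusion. The vector \<open>y\<close> this yields is the one that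
      \<open>Z\<close> must omit.\<close>
    have "\<not> Y \<subseteq> C"
      using Y C rank_mono[of Y C] \<open>r A < r UNIV\<close> by (auto simp: spanning_spaces_def)
    then obtain y where y: "y \<in> Y" "y \<notin> C"
      by blast
    then obtain Z where Z: "codim1_in Z UNIV" "C \<subseteq> Z" "y \<notin> Z"
      using C(1) hyperplane_avoiding_vector by metis
    \<comment> \<open>Since \<open>C \<subseteq> Z\<close>, such a \<open>z\<close> is not inside
      \<open>C\<close>, so adding it raises the integer \<open>r A\<close> by at least one. As
      \<open>r UNIV \<le> r A + 1\<close>, this reaches full rank.\<close>
    have "A + z \<in> spanning_spaces r" if z: "one_dim z" "\<not> z \<subseteq> Z" for z
    proof -
      have "subspace z"
        using z by (simp add: one_dim_def)
      then have sub: "subspace (A + z)" and "r A < r (A + z)"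
        using A Z(2) z(2) flat[of z] by (auto simp: subspace_set_plus)
      moreover have "r UNIV \<le> r A + 1"
        using X rank_le_codim1[OF AX] by (simp add: spanning_spaces_def)
      ultimately show ?thesis
        using rank_mono[of "A + z" UNIV] by (simp add: spanning_spaces_def)
    qed
    then show ?thesis
      using Z C(2) y(1) by blast
  qed
qed

lemma spanning_spaces_F2: "q_delta_F2 (spanning_spaces r)"
  unfolding q_delta_F2_def
proof (intro ballI allI impI disjI2)
  fix X A
  assume X: "X \<in> spanning_spaces r" and XA: "codim1_in X A"
  then have A: "subspace A" "X \<subseteq> A" "subspace X" "dim A = dim X + 1"
    by (auto simp: codim1_in_def)
  \<comment> \<open>\<open>A\<close> has dimension at least 1 because \<open>X\<close> has
    codimension 1 in it, so a line inside \<open>A\<close> exists to serve as \<open>z\<close> in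
    (iv).\<close>
  then obtain x where "x \<in> A" "x \<noteq> 0"
    by (metis add_cancel_right_right subspace_0 subsetI subset_antisym zero_neq_one)
  then have z: "one_dim (span {x})"
    by (simp add: one_dim_span_singleton)
  have "A \<subseteq> A + span {x}"
    by (simp add: subset_set_plus_left)
  then have "A + span {x} \<in> spanning_spaces r"
    using A by (intro spanning_superset[OF X] subspace_set_plus) auto
  with z show "\<exists>z. one_dim z \<and> A + z \<in> spanning_spaces r"
    by blast
qed

lemma spanning_spaces_q_delta_matroid: "q_delta_matroid (spanning_spaces r)"
proof -
  have "UNIV \<in> spanning_spaces r" and "\<forall>X\<in>spanning_spaces r. subspace X"
    by (simp_all add: spanning_spaces_def)
  then show ?thesis
    unfolding q_delta_matroid_def
    using spanning_spaces_F1 spanning_spaces_F2 by blast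
qed

end

end

theorem proposition3p5:
  fixes scale :: "'a::field \<Rightarrow> 'b::ab_group_add \<Rightarrow> 'b"
    and Basis :: "'b set"
    and r :: "'b set \<Rightarrow> int"
  assumes "finite_dimensional_vector_space scale Basis"
    and "finite_dimensional_vector_space.q_matroid scale r"
  shows "finite_dimensional_vector_space.q_delta_matroid scale
           (finite_dimensional_vector_space.spanning_spaces scale r)"
  using assms by (rule finite_dimensional_vector_space.spanning_spaces_q_delta_matroid)

end
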